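(* Let $p,r\ge 1$ and $q\ge 2$ be integers, and let $\Gamma=\mathcal{C}_{p,q,r}$ where $p>q$ and $p>r$, with no restriction on the relative order of $q$ and $r$ (equivalently, $r>q$ and $r>p$, with no restriction on the relative order of $q$ and $p$). Then $\beta(\Gamma)=2$.
   Context: For a connected graph $\Gamma$ with vertex set $V(\Gamma)$, $d(u,v)$ is the length (number of edges) of a shortest path between $u$ and $v$. For an ordered set $R=\{w_1,\dots,w_t\}\subseteq V(\Gamma)$, the representation of a vertex $v$ with respect to $R$ is $(d(v,w_1),\dots,d(v,w_t))$. $R$ is a resolving set if distinct vertices have distinct representations with respect to $R$. The metric dimension $\beta(\Gamma)$ is the minimum cardinality of a resolving set of $\Gamma$. The graph $\mathcal{C}_{p,q,r}$ (base bicyclic graph of type III), for integers $p,r\ge 1$ and $q\ge 2$, is defined as follows. Take three disjoint paths $\mathcal{P}_1=v_1\cdots v_p$, $\mathcal{P}_2=v_{p+1}\cdots v_{p+q}$ and $\mathcal{P}_3=v_{p+q+1}\cdots v_{p+q+r}$ having $p$, $q$ and $r$ vertices respectively; join the starting vertices $v_1$ and $v_{p+q+1}$ of $\mathcal{P}_1$ and $\mathcal{P}_3$ to the starting vertex $v_{p+1}$ of $\mathcal{P}_2$, and join the ending vertices $v_p$ and $v_{p+q+r}$ of $\mathcal{P}_1$ and $\mathcal{P}_3$ to the ending vertex $v_{p+q}$ of $\mathcal{P}_2$ (a one-vertex path has its starting vertex equal to its ending vertex). Thus $v_{p+1}$ and $v_{p+q}$ are joined by three internally disjoint paths of lengths $p+1$,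 $q-1$, $r+1$. Interchanging $p$ and $r$ gives an isomorphic graph: $\mathcal{C}_{p,q,r}\simeq\mathcal{C}_{r,q,p}$. *)

theory Defs
  imports "Graph_Theory.Graph_Theory"
begin

text \<open>
  Finite simple graphs are represented, as usual in \<^theory>\<open>Graph_Theory.Graph_Theory\<close>, by symmetric
  loop-free digraphs (locale \<^locale>\<open>graph\<close>): an edge is a pair of opposite arcs.
\<close>

text \<open>
  The distance is the library's shortest-path cost for the constant arc weight 1. It is an
  extended real, infinite between different components.
\<close>

definition gdist :: "('a, 'b) pre_digraph \<Rightarrow> 'a \<Rightarrow> 'a \<Rightarrow> ereal" where
  "gdist G u v = wf_digraph.\<mu> G (\<lambda>_. 1) u v"

lemma (in fin_digraph) gdist_shortest_path:
  assumes "u \<rightarrow>\<^sup>* v"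
  obtains \<pi> where "apath u \<pi> v" "gdist G u v = length \<pi>"
    "\<And>\<rho>. apath u \<rho> v \<Longrightarrow> length \<pi> \<le> length \<rho>"
proof -
  have cost: "awalk_cost (\<lambda>_. 1) es = length es" for es :: "'b list"
    by (induction es) auto
  obtain \<pi> where \<pi>: "apath u \<pi> v" "\<mu> (\<lambda>_. 1) u v = awalk_cost (\<lambda>_. 1) \<pi>"
    using min_cost_awalk[OF assms, of "\<lambda>_. 1"] by auto
  show ?thesis
  proof
    show "apath u \<pi> v" by fact
    show "gdist G u v = length \<pi>"
      using \<pi> by (simp add: gdist_def cost)
    show "length \<pi> \<le> length \<rho>" if "apath u \<rho> v" for \<rho>
      using min_cost_le_walk_cost[of u \<rho> v "\<lambda>_. 1"] that \<pi> by (simp add: cost apath_def)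
  qed
qed

definition representation :: "('a, 'b) pre_digraph \<Rightarrow> 'a list \<Rightarrow> 'a \<Rightarrow> ereal list" where
  "representation G ws v = map (gdist G v) ws"

text \<open>An ordered set of vertices is a list without repetitions.\<close>

definition resolving_set :: "('a, 'b) pre_digraph \<Rightarrow> 'a list \<Rightarrow> bool" where
  "resolving_set G ws \<longleftrightarrow> distinct ws \<and> set ws \<subseteq> verts G \<and> inj_on (representation G ws) (verts G)"

definition metric_dimension :: "('a, 'b) pre_digraph \<Rightarrow> nat" where
  "metric_dimension G = (LEAST k. \<exists>ws. resolving_set G ws \<and> length ws = k)"

text \<open>The vertex \<open>v\<^sub>i\<close> is the number \<open>i\<close>, and every edge is listed in one orientation only.\<close>

definition path_edges :: "nat \<Rightarrow> nat \<Rightarrow> (nat \<times> nat) set" where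
  "path_edges a b = {(i, i + 1) | i. a \<le> i \<and> i < b}"

definition bicyclic3_edges :: "nat \<Rightarrow> nat \<Rightarrow> nat \<Rightarrow> (nat \<times> nat) set" where
  "bicyclic3_edges p q r =
     path_edges 1 p \<union> path_edges (p + 1) (p + q) \<union> path_edges (p + q + 1) (p + q + r) \<union>
     {(1, p + 1), (p + q + 1, p + 1), (p, p + q), (p + q + r, p + q)}"

definition bicyclic3 :: "nat \<Rightarrow> nat \<Rightarrow> nat \<Rightarrow> nat pair_pre_digraph" where
  "bicyclic3 p q r =
     \<lparr>pverts = {1..p + q + r}, parcs = bicyclic3_edges p q r \<union> (bicyclic3_edges p q r)\<inverse>\<rparr>"

lemma bicyclic3_pair_graph:
  assumes "p \<ge> 1" "q \<ge> 2" "r \<ge> 1"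
  shows "pair_graph (bicyclic3 p q r)"
proof -
  let ?E = "bicyclic3_edges p q r" and ?V = "{1..p + q + r}"
  have sub: "?E \<subseteq> ?V \<times> ?V"
    using assms by (auto simp: bicyclic3_edges_def path_edges_def)
  then have fin: "finite ?E"
    by (rule finite_subset) simp
  have irr: "a \<noteq> b" if "(a, b) \<in> ?E" for a b
    using that assms by (auto simp: bicyclic3_edges_def path_edges_def)
  show ?thesis
  proof
    fix e assume "e \<in> parcs (bicyclic3 p q r)"
    then show "fst e \<in> pverts (bicyclic3 p q r)" "snd e \<in> pverts (bicyclic3 p q r)" "fst e \<noteq> snd e"
      using sub irr[of "fst e" "snd e"] irr[of "snd e" "fst e"]
      by (cases e; auto simp: bicyclic3_def)+
  qed (use fin in \<open>auto simp: bicyclic3_def symmetric_def sym_def arcs_ends_def arc_to_ends_def\<close>)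
qed

lemma bicyclic3_connected:
  assumes "p \<ge> 1" "q \<ge> 2" "r \<ge> 1"
  shows "connected (with_proj (bicyclic3 p q r))"
proof -
  let ?G = "with_proj (bicyclic3 p q r)"
  interpret pair_graph "bicyclic3 p q r" using assms by (rule bicyclic3_pair_graph)
  have arc: "a \<rightarrow>\<^sup>*\<^bsub>?G\<^esub> b" if "(a, b) \<in> bicyclic3_edges p q r" for a b
    using that by (intro reachable_adjI) (fastforce simp: bicyclic3_def)
  have path: "a \<rightarrow>\<^sup>*\<^bsub>?G\<^esub> i"
    if "path_edges a b \<subseteq> bicyclic3_edges p q r" "a \<le> i" "i \<le> b" "a \<in> verts ?G" for a b i
    using \<open>a \<le> i\<close> \<open>i \<le> b\<close>
  proof (induction i rule: dec_induct)
    case (step n)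
    then have "n \<rightarrow>\<^sup>*\<^bsub>?G\<^esub> Suc n"
      using that(1) by (intro arc) (auto simp: path_edges_def)
    with step show ?case using reachable_trans by auto
  qed (use that in auto)
  have rev: "b \<rightarrow>\<^sup>*\<^bsub>?G\<^esub> a" if "a \<rightarrow>\<^sup>*\<^bsub>?G\<^esub> b" for a b
    using that symmetric_reachable[OF sym_arcs] by simp
  have root: "(p + 1) \<rightarrow>\<^sup>*\<^bsub>?G\<^esub> i" if i: "i \<in> verts ?G" for i
  proof -
    have "(p + 1) \<rightarrow>\<^sup>*\<^bsub>?G\<^esub> 1"
      by (rule rev, rule arc) (simp add: bicyclic3_edges_def)
    have "(p + 1) \<rightarrow>\<^sup>*\<^bsub>?G\<^esub> (p + q + 1)"
      by (rule rev, rule arc) (simp add: bicyclic3_edges_def)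
    consider "1 \<le> i" "i \<le> p" | "p + 1 \<le> i" "i \<le> p + q" | "p + q + 1 \<le> i" "i \<le> p + q + r"
      using i by (force simp: bicyclic3_def)
    then show ?thesis
    proof cases
      case 1
      then have "1 \<rightarrow>\<^sup>*\<^bsub>?G\<^esub> i"
        using assms by (intro path[of 1 p]) (auto simp: bicyclic3_edges_def bicyclic3_def)
      with \<open>(p + 1) \<rightarrow>\<^sup>*\<^bsub>?G\<^esub> 1\<close> show ?thesis by (rule reachable_trans)
    next
      case 2
      then show ?thesis
        using assms by (intro path[of "p + 1" "p + q"]) (auto simp: bicyclic3_edges_def bicyclic3_def)
    next
      case 3
      then have "(p + q + 1) \<rightarrow>\<^sup>*\<^bsub>?G\<^esub> i"
        using assms
        by (intro path[of "p + q + 1" "p + q + r"]) (auto simp: bicyclic3_edges_def bicyclic3_def)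
      with \<open>(p + 1) \<rightarrow>\<^sup>*\<^bsub>?G\<^esub> (p + q + 1)\<close> show ?thesis by (rule reachable_trans)
    qed
  qed
  have "strongly_connected ?G"
  proof (rule strongly_connectedI)
    show "verts ?G \<noteq> {}" using assms by (fastforce simp: bicyclic3_def)
    show "u \<rightarrow>\<^sup>*\<^bsub>?G\<^esub> v" if "u \<in> verts ?G" "v \<in> verts ?G" for u v
      using reachable_trans[OF rev[OF root[OF that(1)]] root[OF that(2)]] .
  qed
  moreover have "pverts (mk_symmetric ?G) = verts ?G" by (simp add: mk_symmetric_def)
  ultimately show ?thesis
    using reachable_mk_symmetricI unfolding connected_def strongly_connected_def by simp
qed

end

theory Submission
  imports Defs
begin

text \<open>
  By the symmetry exchanging \<open>p\<close> and \<open>r\<close> let the path through \<open>v\<^sub>1, \<dots>, v\<^sub>p\<close> be the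
  longest of the three, and let \<open>s = min (q - 1) (r + 1)\<close> be the length of the shortest one.
  If the two other lengths differ, \<open>v\<^sub>1\<close> and a vertex of the same path almost opposite to it
  in the cycle of length \<open>p + 1 + s\<close> resolve the graph: the sum of the two distances separates
  one arc of that cycle, the second distance the other arc. If \<open>q - 1 = r + 1\<close>, no pair of
  vertices on the long path can tell the two equal paths apart, and the neighbours
  \<open>1\<close> and \<open>p + q + 1\<close> of one branch vertex are used instead. One vertex is never enough,
  because every vertex has two neighbours.
\<close>

section \<open>Distances and resolving sets\<close>

context wf_digraph
begin

lemma awalk_cost_one: "awalk_cost (\<lambda>_. 1) es = length es"
  by (induction es) auto

lemma gdist_le_awalk: "awalk u es v \<Longrightarrow> gdist G u v \<le> length es"
  using min_cost_le_walk_cost[of u es v "\<lambda>_. 1"] by (simp add: gdist_def awalk_cost_one)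

lemma gdist_greatest:
  assumes "\<And>es. awalk u es v \<Longrightarrow> c \<le> ereal (length es)"
  shows "c \<le> gdist G u v"
  unfolding gdist_def \<mu>_def using assms by (auto intro!: INF_greatest simp: awalk_cost_one)

text \<open>Following descending arcs gives a walk to \<open>w\<close> of length at most
  \<open>f v\<close>; since \<open>f\<close> loses at most 1 per arc, no walk to \<open>w\<close> is
  shorter. A closed distance formula can thus be certified locally, without exhibiting shortest
  paths.\<close>

lemma gdist_eqI:
  fixes f :: "'a \<Rightarrow> nat"
  assumes "v \<in> verts G"
    and zero: "\<And>u. u \<in> verts G \<Longrightarrow> f u = 0 \<longleftrightarrow> u = w"
    and lipschitz: "\<And>e. e \<in> arcs G \<Longrightarrow> f (tail G e) \<le> f (head G e) + 1"
    and descent: "\<And>u. u \<in> verts G \<Longrightarrow> u \<noteq> w \<Longrightarrow> \<exists>e\<in>arcs G. tail G e = u \<and> f (head G e) < f u"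
  shows "gdist G v w = f v"
proof (rule antisym)
  have "\<exists>es. awalk v es w \<and> length es \<le> f v"
    using \<open>v \<in> verts G\<close>
  proof (induction "f v" arbitrary: v rule: less_induct)
    case less
    show ?case
    proof (cases "v = w")
      case True
      then have "awalk v [] w" using less.prems by (simp add: awalk_Nil_iff)
      then show ?thesis by force
    next
      case False
      then obtain e where e: "e \<in> arcs G" "tail G e = v" "f (head G e) < f v"
        using descent less.prems by blast
      then obtain es where "awalk (head G e) es w" "length es \<le> f (head G e)"
        using less.hyps[of "head G e"] by auto
      with e have "awalk v (e # es) w" "length (e # es) \<le> f v"
        by (auto simp: awalk_Cons_iff)
      then show ?thesis by blast
    qed
  qed
  then obtain es where "awalk v es w" "length es \<le> f v" by blast
  then show "gdist G v w \<le> f v"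
    using gdist_le_awalk[of v es w] by (meson ereal_less_eq(3) of_nat_le_iff order_trans)
next
  have "f u \<le> length es" if "awalk u es w" for u es
    using that
  proof (induction es arbitrary: u)
    case Nil
    then show ?case using zero[of w] by (auto simp: awalk_Nil_iff)
  next
    case (Cons e es)
    then show ?case
      using lipschitz[of e] by (fastforce simp: awalk_Cons_iff)
  qed
  then show "f v \<le> gdist G v w"
    by (intro gdist_greatest) simp
qed

end

section \<open>Distances and resolving sets under isomorphisms\<close>

text \<open>The image of a walk under an arc-preserving map is a walk of the same length; arcs are
  pairs here, so the map acts on them as \<open>map_prod \<phi> \<phi>\<close>.\<close>

lemma gdist_hom_le:
  assumes "wf_digraph (with_proj G)" "wf_digraph (with_proj H)"
    and verts: "\<And>x. x \<in> pverts G \<Longrightarrow> \<phi> x \<in> pverts H"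
    and arcs: "\<And>x y. (x, y) \<in> parcs G \<Longrightarrow> (\<phi> x, \<phi> y) \<in> parcs H"
  shows "gdist (with_proj H) (\<phi> u) (\<phi> v) \<le> gdist (with_proj G) u v"
proof -
  interpret G: wf_digraph "with_proj G" by fact
  interpret H: wf_digraph "with_proj H" by fact
  have "H.awalk (\<phi> u) (map (map_prod \<phi> \<phi>) es) (\<phi> v)" if "G.awalk u es v" for es
    using that
    by (induction es arbitrary: u)
      (auto simp: G.awalk_Nil_iff H.awalk_Nil_iff G.awalk_Cons_iff H.awalk_Cons_iff verts arcs)
  then have "gdist (with_proj H) (\<phi> u) (\<phi> v) \<le> length es" if "G.awalk u es v" for es
    using H.gdist_le_awalk[of "\<phi> u" "map (map_prod \<phi> \<phi>) es" "\<phi> v"] that by simp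
  then show ?thesis by (rule G.gdist_greatest)
qed

lemma gdist_iso:
  assumes "wf_digraph (with_proj G)" "wf_digraph (with_proj H)"
    and \<phi>: "\<And>x. x \<in> pverts G \<Longrightarrow> \<phi> x \<in> pverts H"
      "\<And>x y. (x, y) \<in> parcs G \<Longrightarrow> (\<phi> x, \<phi> y) \<in> parcs H"
    and \<psi>: "\<And>x. x \<in> pverts H \<Longrightarrow> \<psi> x \<in> pverts G"
      "\<And>x y. (x, y) \<in> parcs H \<Longrightarrow> (\<psi> x, \<psi> y) \<in> parcs G"
    and inv: "\<And>x. x \<in> pverts G \<Longrightarrow> \<psi> (\<phi> x) = x"
    and "u \<in> pverts G" "v \<in> pverts G"
  shows "gdist (with_proj H) (\<phi> u) (\<phi> v) = gdist (with_proj G) u v"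
proof (rule antisym)
  show "gdist (with_proj H) (\<phi> u) (\<phi> v) \<le> gdist (with_proj G) u v"
    using assms(1,2) \<phi> by (rule gdist_hom_le)
  have "gdist (with_proj G) (\<psi> (\<phi> u)) (\<psi> (\<phi> v)) \<le> gdist (with_proj H) (\<phi> u) (\<phi> v)"
    using assms(2,1) \<psi> by (rule gdist_hom_le)
  then show "gdist (with_proj G) u v \<le> gdist (with_proj H) (\<phi> u) (\<phi> v)"
    using inv assms(8,9) by simp
qed

text \<open>Composed with \<open>\<phi>\<close>, the new representation is the old one, so
  injectivity passes to the image.\<close>

lemma resolving_set_isometry:
  assumes bij: "bij_betw \<phi> (verts G) (verts H)"
    and gdist: "\<And>u v. u \<in> verts G \<Longrightarrow> v \<in> verts G \<Longrightarrow> gdist H (\<phi> u) (\<phi> v) = gdist G u v"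
    and "resolving_set G ws"
  shows "resolving_set H (map \<phi> ws)"
proof -
  have ws: "distinct ws" "set ws \<subseteq> verts G" "inj_on (representation G ws) (verts G)"
    using assms(3) by (auto simp: resolving_set_def)
  have \<phi>: "inj_on \<phi> (verts G)" "\<phi> ` verts G = verts H"
    using bij by (auto simp: bij_betw_def)
  have "(representation H (map \<phi> ws) \<circ> \<phi>) x = representation G ws x" if "x \<in> verts G" for x
    using that ws(2) gdist[of x] by (auto simp: representation_def)
  then have "inj_on (representation H (map \<phi> ws) \<circ> \<phi>) (verts G)"
    using ws(3) by (simp cong: inj_on_cong)
  then have "inj_on (representation H (map \<phi> ws)) (verts H)"
    using \<phi>(2) inj_on_imageI[of _ \<phi> "verts G"] by simp
  moreover have "inj_on \<phi> (set ws)" "\<phi> ` set ws \<subseteq> verts H"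
    using ws(2) \<phi> inj_on_subset by blast+
  ultimately show ?thesis
    using ws(1) by (simp add: resolving_set_def distinct_map)
qed

section \<open>Lower bound on the size of a resolving set\<close>

text \<open>A shortest path turns the extended real distance into a natural number, and the single
  arc bounds it by 1. The value 0 covers a loop.\<close>

lemma (in fin_digraph) gdist_out_neighbour:
  assumes "u \<rightarrow>\<^bsub>G\<^esub> w"
  shows "gdist G u w \<in> {0, 1}"
proof -
  obtain \<pi> where \<pi>: "apath u \<pi> w" "gdist G u w = length \<pi>"
    using gdist_shortest_path[OF reachable_adjI[OF assms]] by blast
  obtain e where "e \<in> arcs G" "tail G e = u" "head G e = w"
    using assms by (auto simp: arcs_ends_def arc_to_ends_def)
  then have "awalk u [e] w" by (auto simp: awalk_simps)
  from gdist_le_awalk[OF this] \<pi>(2) have "length \<pi> \<le> 1" by simp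
  then have "length \<pi> = 0 \<or> length \<pi> = 1" by linarith
  then show ?thesis using \<pi>(2) by auto
qed

text \<open>
  A vertex and two of its in-neighbours have distances in \<open>{0, 1}\<close> to it, so it does not
  resolve these three vertices.
\<close>

lemma (in fin_digraph) resolving_set_length_ge_2:
  assumes "resolving_set G ws" "verts G \<noteq> {}"
    and deg: "\<And>w. w \<in> verts G \<Longrightarrow> \<exists>u v. u \<rightarrow>\<^bsub>G\<^esub> w \<and> v \<rightarrow>\<^bsub>G\<^esub> w \<and> distinct [u, v, w]"
  shows "length ws \<ge> 2"
proof (rule ccontr)
  assume "\<not> length ws \<ge> 2"
  then consider "ws = []" | w where "ws = [w]"
    by (cases ws; cases "tl ws") auto
  \<comment> \<open>The empty list is treated like a singleton: any vertex can serve as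
    \<open>w\<close>, since the rest relies only on \<open>set ws \<subseteq> {w}\<close>.\<close>
  then obtain w where w: "w \<in> verts G" and "set ws \<subseteq> {w}"
    using assms(1,2) by cases (auto simp: resolving_set_def)
  obtain u v where uv: "u \<rightarrow>\<^bsub>G\<^esub> w" "v \<rightarrow>\<^bsub>G\<^esub> w" "distinct [u, v, w]"
    using deg[OF w] by blast
  have "gdist G w w = 0"
  proof (rule antisym)
    have "awalk w [] w" using w by (simp add: awalk_Nil_iff)
    from gdist_le_awalk[OF this] show "gdist G w w \<le> 0" by (simp add: zero_ereal_def)
    show "0 \<le> gdist G w w" by (rule gdist_greatest) simp
  qed
  then have "gdist G u w = gdist G v w \<or> gdist G u w = gdist G w w \<or> gdist G v w = gdist G w w"
    using gdist_out_neighbour[OF uv(1)] gdist_out_neighbour[OF uv(2)] by auto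
  then have "\<not> inj_on (\<lambda>x. gdist G x w) {u, v, w}"
    using uv(3) by (auto simp: inj_on_def)
  moreover have "{u, v, w} \<subseteq> verts G"
    using uv w by (auto dest: adj_in_verts)
  ultimately obtain x y where xy: "x \<in> verts G" "y \<in> verts G" "x \<noteq> y" "gdist G x w = gdist G y w"
    unfolding inj_on_def by blast
  then have "representation G ws x = representation G ws y"
    using \<open>set ws \<subseteq> {w}\<close> by (auto simp: representation_def)
  then show False
    using assms(1) xy by (auto simp: resolving_set_def inj_on_def)
qed

section \<open>Adjacency and symmetry of the graph\<close>

definition bicyclic3_adj :: "nat \<Rightarrow> nat \<Rightarrow> nat \<Rightarrow> nat \<Rightarrow> nat \<Rightarrow> bool" where
  "bicyclic3_adj p q r u v \<longleftrightarrow> (u, v) \<in> bicyclic3_edges p q r \<or> (v, u) \<in> bicyclic3_edges p q r"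

lemma bicyclic3_adj_sym: "bicyclic3_adj p q r u v \<Longrightarrow> bicyclic3_adj p q r v u"
  by (auto simp: bicyclic3_adj_def)

lemma bicyclic3_arc_iff: "(u, v) \<in> parcs (bicyclic3 p q r) \<longleftrightarrow> bicyclic3_adj p q r u v"
  by (auto simp: bicyclic3_def bicyclic3_adj_def)

lemma path_edges_iff: "(u, v) \<in> path_edges a b \<longleftrightarrow> v = u + 1 \<and> a \<le> u \<and> u < b"
  by (auto simp: path_edges_def)

lemma bicyclic3_edges_cases:
  assumes "(u, v) \<in> bicyclic3_edges p q r"
  obtains
    "v = u + 1" "1 \<le> u" "u < p" | "v = u + 1" "p + 1 \<le> u" "u < p + q"
  | "v = u + 1" "p + q + 1 \<le> u" "u < p + q + r"
  | "u = 1" "v = p + 1" | "u = p + q + 1" "v = p + 1" | "u = p" "v = p + q" | "u = p + q + r" "v = p + q"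
  using assms unfolding bicyclic3_edges_def Un_iff insert_iff empty_iff path_edges_iff prod.inject by blast

lemma bicyclic3_adjI:
  "1 \<le> u \<Longrightarrow> u < p \<Longrightarrow> bicyclic3_adj p q r u (u + 1)"
  "p + 1 \<le> u \<Longrightarrow> u < p + q \<Longrightarrow> bicyclic3_adj p q r u (u + 1)"
  "p + q + 1 \<le> u \<Longrightarrow> u < p + q + r \<Longrightarrow> bicyclic3_adj p q r u (u + 1)"
  "bicyclic3_adj p q r 1 (p + 1)" "bicyclic3_adj p q r (p + q + 1) (p + 1)"
  "bicyclic3_adj p q r p (p + q)" "bicyclic3_adj p q r (p + q + r) (p + q)"
  by (simp_all add: bicyclic3_adj_def bicyclic3_edges_def path_edges_iff)

text \<open>Path edges seen from their upper end, in a form that unifies with goals about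
  \<open>w - 1\<close>.\<close>

lemma bicyclic3_adj_predI:
  "1 < w \<Longrightarrow> w \<le> p \<Longrightarrow> bicyclic3_adj p q r (w - 1) w"
  "p + 1 < w \<Longrightarrow> w \<le> p + q \<Longrightarrow> bicyclic3_adj p q r (w - 1) w"
  "p + q + 1 < w \<Longrightarrow> w \<le> p + q + r \<Longrightarrow> bicyclic3_adj p q r (w - 1) w"
  using bicyclic3_adjI(1)[of "w - 1" p q r] bicyclic3_adjI(2)[of p "w - 1" q r]
    bicyclic3_adjI(3)[of p q "w - 1" r] by simp_all

lemmas bicyclic3_adj_intros =
  bicyclic3_adjI[simplified] bicyclic3_adjI[THEN bicyclic3_adj_sym, simplified]
  bicyclic3_adj_predI[simplified]

text \<open>A vertex of the first or third path has one neighbour towards \<open>p + 1\<close> and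
  one towards \<open>p + q\<close>; these differ even on a one-vertex path because
  \<open>q \<ge> 2\<close>. A branch vertex has a neighbour on the second path and one on the first
  or third.\<close>

lemma bicyclic3_two_neighbours:
  assumes "p \<ge> 1" "q \<ge> 2" "r \<ge> 1" "w \<in> {1..p + q + r}"
  shows "\<exists>u v. bicyclic3_adj p q r u w \<and> bicyclic3_adj p q r v w \<and> distinct [u, v, w]"
proof -
  consider "1 \<le> w" "w \<le> p" | "w = p + 1" | "p + 1 < w" "w < p + q" | "w = p + q"
    | "p + q < w" "w \<le> p + q + r"
    using assms(4) by fastforce
  then show ?thesis
  proof cases
    case 1
    obtain u where u: "bicyclic3_adj p q r u w" "u < w \<or> u = p + 1"
    proof (cases "w = 1")
      case True
      then show ?thesis using that[of "p + 1"] by (simp add: bicyclic3_adj_intros)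
    next
      case False
      then show ?thesis using that[of "w - 1"] 1 by (simp add: bicyclic3_adj_intros)
    qed
    obtain v where v: "bicyclic3_adj p q r v w" "w < v \<and> v \<le> p \<or> v = p + q"
    proof (cases "w = p")
      case True
      then show ?thesis using that[of "p + q"] by (simp add: bicyclic3_adj_intros)
    next
      case False
      then show ?thesis using that[of "w + 1"] 1 by (simp add: bicyclic3_adj_intros)
    qed
    have "distinct [u, v, w]" using 1 u(2) v(2) assms(2) by auto
    with u v show ?thesis by blast
  next
    case 2
    have "distinct [p + 2, p + q + 1, w]" using 2 assms by simp
    moreover have "bicyclic3_adj p q r (p + 2) w" "bicyclic3_adj p q r (p + q + 1) w"
      using 2 assms bicyclic3_adjI(2)[of p "p + 1" q r, THEN bicyclic3_adj_sym] bicyclic3_adjI(5)[of p q r]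
      by simp_all
    ultimately show ?thesis by blast
  next
    case 3
    have "distinct [w - 1, w + 1, w]" using 3 by auto
    moreover have "bicyclic3_adj p q r (w - 1) w" "bicyclic3_adj p q r (w + 1) w"
      using 3 bicyclic3_adjI(2)[of p w q r, THEN bicyclic3_adj_sym] bicyclic3_adj_predI(2)[of p w q r]
      by simp_all
    ultimately show ?thesis by blast
  next
    case 4
    have "distinct [p, p + q - 1, w]" using 4 assms by auto
    moreover have "bicyclic3_adj p q r p w" "bicyclic3_adj p q r (p + q - 1) w"
      using 4 assms bicyclic3_adjI(6)[of p q r] bicyclic3_adj_predI(2)[of p w q r] by simp_all
    ultimately show ?thesis by blast
  next
    case 5
    \<comment> \<open>The last disjunct rules out \<open>u = p + q\<close>, which is a possible
      value of \<open>v\<close>.\<close>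
    obtain u where u: "bicyclic3_adj p q r u w" "u < w" "u = p + 1 \<or> p + q < u"
    proof (cases "w = p + q + 1")
      case True
      then show ?thesis using that[of "p + 1"] assms by (simp add: bicyclic3_adj_intros)
    next
      case False
      then have "p + q < w - 1" using 5 by auto
      then show ?thesis using that[of "w - 1"] 5 by (simp add: bicyclic3_adj_intros)
    qed
    obtain v where v: "bicyclic3_adj p q r v w" "v = p + q \<or> w < v"
    proof (cases "w = p + q + r")
      case True
      then show ?thesis using that[of "p + q"] by (simp add: bicyclic3_adj_intros)
    next
      case False
      then show ?thesis using that[of "w + 1"] 5 by (simp add: bicyclic3_adj_intros)
    qed
    have "distinct [u, v, w]" using 5 u(2,3) v(2) assms(2) by auto
    with u v show ?thesis by blast
  qed
qed

section \<open>The isomorphism exchanging the first and third path\<close>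

text \<open>Each of the three blocks of labels is shifted as a whole and keeps its orientation, so
  starting vertices go to starting vertices. The inverse is the same map with \<open>p\<close> and
  \<open>r\<close> exchanged.\<close>

definition bicyclic3_swap :: "nat \<Rightarrow> nat \<Rightarrow> nat \<Rightarrow> nat \<Rightarrow> nat" where
  "bicyclic3_swap p q r v = (if v \<le> p then v + q + r else if v \<le> p + q then v - p + r else v - p - q)"

lemma bicyclic3_swap_vert:
  "v \<in> {1..p + q + r} \<Longrightarrow> bicyclic3_swap p q r v \<in> {1..p + q + r}"
  by (auto simp: bicyclic3_swap_def)

lemma bicyclic3_swap_swap:
  "v \<in> {1..p + q + r} \<Longrightarrow> bicyclic3_swap r q p (bicyclic3_swap p q r v) = v"
  by (auto simp: bicyclic3_swap_def)

text \<open>Of the seven kinds of edges, those of the second path are kept, and the kinds belonging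
  to the first path are exchanged with those of the third.\<close>

lemma bicyclic3_swap_adj:
  assumes "p \<ge> 1" "q \<ge> 2" "r \<ge> 1" "bicyclic3_adj p q r u v"
  shows "bicyclic3_adj r q p (bicyclic3_swap p q r u) (bicyclic3_swap p q r v)"
proof -
  have "bicyclic3_adj r q p (bicyclic3_swap p q r u) (bicyclic3_swap p q r v)"
    if "(u, v) \<in> bicyclic3_edges p q r" for u v
    using that
  proof (cases rule: bicyclic3_edges_cases)
    case 1
    then show ?thesis
      using bicyclic3_adjI(3)[of r q "u + q + r" p] by (simp add: bicyclic3_swap_def add_ac)
  next
    case 2
    then show ?thesis
      using bicyclic3_adjI(2)[of r "u - p + r" q p] by (simp add: bicyclic3_swap_def add_ac Suc_diff_le)
  next
    case 3
    then show ?thesis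
      using bicyclic3_adjI(1)[of "u - p - q" r q p] by (simp add: bicyclic3_swap_def Suc_diff_le)
  next
    case 4
    then show ?thesis
      using bicyclic3_adjI(5)[of r q p] assms by (simp add: bicyclic3_swap_def add_ac)
  next
    case 5
    then show ?thesis
      using bicyclic3_adjI(4)[of r q p] assms by (simp add: bicyclic3_swap_def)
  next
    case 6
    then show ?thesis
      using bicyclic3_adjI(7)[of r q p] assms by (simp add: bicyclic3_swap_def add_ac)
  next
    case 7
    then show ?thesis
      using bicyclic3_adjI(6)[of r q p] assms by (simp add: bicyclic3_swap_def add_ac)
  qed
  then show ?thesis
    using assms(4) unfolding bicyclic3_adj_def[of p q r u v] by (blast intro: bicyclic3_adj_sym)
qed

lemma gdist_bicyclic3_swap:
  assumes "p \<ge> 1" "q \<ge> 2" "r \<ge> 1" "u \<in> {1..p + q + r}" "v \<in> {1..p + q + r}"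
  shows "gdist (with_proj (bicyclic3 r q p)) (bicyclic3_swap p q r u) (bicyclic3_swap p q r v) =
    gdist (with_proj (bicyclic3 p q r)) u v"
proof (rule gdist_iso)
  interpret G: pair_graph "bicyclic3 p q r" using assms by (intro bicyclic3_pair_graph)
  interpret H: pair_graph "bicyclic3 r q p" using assms by (intro bicyclic3_pair_graph)
  show "wf_digraph (with_proj (bicyclic3 p q r))" "wf_digraph (with_proj (bicyclic3 r q p))"
    by unfold_locales
  show "bicyclic3_swap p q r x \<in> pverts (bicyclic3 r q p)" if "x \<in> pverts (bicyclic3 p q r)" for x
    using bicyclic3_swap_vert[of x p q r] that by (simp add: bicyclic3_def)
  show "bicyclic3_swap r q p x \<in> pverts (bicyclic3 p q r)" if "x \<in> pverts (bicyclic3 r q p)" for x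
    using bicyclic3_swap_vert[of x r q p] that by (simp add: bicyclic3_def)
  show "bicyclic3_swap r q p (bicyclic3_swap p q r x) = x" if "x \<in> pverts (bicyclic3 p q r)" for x
    using bicyclic3_swap_swap[of x p q r] that by (simp add: bicyclic3_def)
  show "(bicyclic3_swap p q r x, bicyclic3_swap p q r y) \<in> parcs (bicyclic3 r q p)"
    if "(x, y) \<in> parcs (bicyclic3 p q r)" for x y
    using bicyclic3_swap_adj[of p q r x y] that assms by (simp add: bicyclic3_arc_iff)
  show "(bicyclic3_swap r q p x, bicyclic3_swap r q p y) \<in> parcs (bicyclic3 p q r)"
    if "(x, y) \<in> parcs (bicyclic3 r q p)" for x y
    using bicyclic3_swap_adj[of r q p x y] that assms by (simp add: bicyclic3_arc_iff)
qed (use assms in \<open>auto simp: bicyclic3_def\<close>)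

lemma resolving_set_bicyclic3_swap:
  assumes "p \<ge> 1" "q \<ge> 2" "r \<ge> 1" "resolving_set (with_proj (bicyclic3 p q r)) ws"
  shows "resolving_set (with_proj (bicyclic3 r q p)) (map (bicyclic3_swap p q r) ws)"
proof (rule resolving_set_isometry)
  show "bij_betw (bicyclic3_swap p q r) (verts (with_proj (bicyclic3 p q r)))
      (verts (with_proj (bicyclic3 r q p)))"
  proof (rule bij_betw_byWitness[where f' = "bicyclic3_swap r q p"])
    show "\<forall>v\<in>verts (with_proj (bicyclic3 p q r)). bicyclic3_swap r q p (bicyclic3_swap p q r v) = v"
      using bicyclic3_swap_swap[of _ p q r] by (simp add: bicyclic3_def)
    show "\<forall>v\<in>verts (with_proj (bicyclic3 r q p)). bicyclic3_swap p q r (bicyclic3_swap r q p v) = v"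
      using bicyclic3_swap_swap[of _ r q p] by (simp add: bicyclic3_def)
    show "bicyclic3_swap p q r ` verts (with_proj (bicyclic3 p q r)) \<subseteq> verts (with_proj (bicyclic3 r q p))"
      using bicyclic3_swap_vert[of _ p q r] by (fastforce simp: bicyclic3_def)
    show "bicyclic3_swap r q p ` verts (with_proj (bicyclic3 r q p)) \<subseteq> verts (with_proj (bicyclic3 p q r))"
      using bicyclic3_swap_vert[of _ r q p] by (fastforce simp: bicyclic3_def)
  qed
  show "gdist (with_proj (bicyclic3 r q p)) (bicyclic3_swap p q r u) (bicyclic3_swap p q r v) =
      gdist (with_proj (bicyclic3 p q r)) u v"
    if "u \<in> verts (with_proj (bicyclic3 p q r))" "v \<in> verts (with_proj (bicyclic3 p q r))" for u v
    using gdist_bicyclic3_swap[OF assms(1-3), of u v] that by (simp add: bicyclic3_def)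
qed (use assms in auto)

section \<open>Distances to a vertex of the first path\<close>

text \<open>
  The hubs are the branch vertices \<open>p + 1\<close> and \<open>p + q\<close>; a shortest walk to \<open>x\<close> from outside the
  first path passes through one of them.
\<close>

definition hub_start_dist :: "nat \<Rightarrow> nat \<Rightarrow> nat \<Rightarrow> nat \<Rightarrow> nat" where
  "hub_start_dist p q r x = min x (p + 1 - x + min (q - 1) (r + 1))"

definition hub_end_dist :: "nat \<Rightarrow> nat \<Rightarrow> nat \<Rightarrow> nat \<Rightarrow> nat" where
  "hub_end_dist p q r x = min (p + 1 - x) (x + min (q - 1) (r + 1))"

text \<open>Outside the first path the two terms are the routes through the start hub and the end
  hub. On the first path the direct route competes as well; in truncated subtraction,
  \<open>v - x + (x - v)\<close> is the absolute difference.\<close>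

definition bicyclic3_dist :: "nat \<Rightarrow> nat \<Rightarrow> nat \<Rightarrow> nat \<Rightarrow> nat \<Rightarrow> nat" where
  "bicyclic3_dist p q r x v =
    (let a = hub_start_dist p q r x; b = hub_end_dist p q r x in
     if v \<le> p then min (v - x + (x - v)) (min (a + v) (b + (p + 1 - v)))
     else if v \<le> p + q then min (a + (v - (p + 1))) (b + (p + q - v))
     else min (a + (v - (p + q))) (b + (p + q + r + 1 - v)))"

text \<open>Facts 1 to 8 give the Lipschitz property of the distance formula at the hubs. Facts 9
  and 10 name a path along which a hub is reached optimally, hence a descending neighbour.\<close>

lemma hub_dist_bounds:
  assumes "p \<ge> 1" "q \<ge> 2" "r \<ge> 1" "x \<in> {1..p}"
    and "a = hub_start_dist p q r x" "b = hub_end_dist p q r x"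
  shows "a \<ge> 1" "b \<ge> 1" "a \<le> x" "b \<le> p + 1 - x" "a \<le> b + (q - 1)" "b \<le> a + (q - 1)"
    "a \<le> b + (r + 1)" "b \<le> a + (r + 1)"
    "a = x \<or> a = b + (q - 1) \<or> a = b + (r + 1)"
    "b = p + 1 - x \<or> b = a + (q - 1) \<or> b = a + (r + 1)"
proof -
  \<comment> \<open>With \<open>y\<close> and \<open>s\<close> in place of the subtraction and the
    inner minimum, everything is linear. If \<open>a = y + s\<close>, then
    \<open>y + s \<le> x\<close>, which forces \<open>b = y\<close> and so \<open>a = b + s\<close>;
    symmetrically for \<open>b\<close>.\<close>
  define y where "y = p + 1 - x"
  then have y: "p + 1 - x = y" "p + 1 = x + y"
    using assms(4) by auto
  obtain s where s: "s = min (q - 1) (r + 1)" by blast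
  then have "s \<le> q - 1" "s \<le> r + 1" "s = q - 1 \<or> s = r + 1" "1 \<le> s"
    using assms by auto
  moreover have "a \<le> x" "a \<le> y + s" "a = x \<or> a = y + s"
    unfolding assms(5) hub_start_dist_def y(1) s[symmetric] by auto
  moreover have "b \<le> y" "b \<le> x + s" "b = y \<or> b = x + s"
    unfolding assms(6) hub_end_dist_def y(1) s[symmetric] by auto
  moreover have "1 \<le> x" "1 \<le> y" using assms(4) y by auto
  ultimately show "a \<ge> 1" "b \<ge> 1" "a \<le> x" "b \<le> p + 1 - x" "a \<le> b + (q - 1)" "b \<le> a + (q - 1)"
    "a \<le> b + (r + 1)" "b \<le> a + (r + 1)"
    "a = x \<or> a = b + (q - 1) \<or> a = b + (r + 1)"
    "b = p + 1 - x \<or> b = a + (q - 1) \<or> b = a + (r + 1)"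
    unfolding y(1) by linarith+
qed

lemma bicyclic3_dist_regions:
  fixes p q r x v :: nat
  defines "a \<equiv> hub_start_dist p q r x" and "b \<equiv> hub_end_dist p q r x"
  shows "v \<le> p \<Longrightarrow> bicyclic3_dist p q r x v = min (v - x + (x - v)) (min (a + v) (b + (p + 1 - v)))"
    and "p + 1 \<le> v \<Longrightarrow> v \<le> p + q \<Longrightarrow> bicyclic3_dist p q r x v = min (a + (v - (p + 1))) (b + (p + q - v))"
    and "p + q + 1 \<le> v \<Longrightarrow> bicyclic3_dist p q r x v = min (a + (v - (p + q))) (b + (p + q + r + 1 - v))"
  by (simp_all add: bicyclic3_dist_def Let_def a_def b_def)

section \<open>Verification of the distance formula\<close>

text \<open>Both hub distances are positive, so only the direct term on the first path can
  vanish.\<close>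

lemma bicyclic3_dist_eq_0_iff:
  assumes "p \<ge> 1" "q \<ge> 2" "r \<ge> 1" "x \<in> {1..p}"
  shows "bicyclic3_dist p q r x v = 0 \<longleftrightarrow> v = x"
proof -
  note ab = hub_dist_bounds(1,2)[OF assms refl refl]
  have min0: "min m n = 0 \<longleftrightarrow> m = 0 \<or> n = 0" for m n :: nat by (auto simp: min_def)
  consider "v \<le> p" | "p + 1 \<le> v" "v \<le> p + q" | "p + q + 1 \<le> v" by linarith
  then show ?thesis
  proof cases
    case 1
    then show ?thesis using ab unfolding bicyclic3_dist_regions(1)[OF 1] min0 by auto
  next
    case 2
    then show ?thesis using ab assms(4) unfolding bicyclic3_dist_regions(2)[OF 2] min0 by auto
  next
    case 3
    then show ?thesis using ab assms(4) unfolding bicyclic3_dist_regions(3)[OF 3] min0 by auto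
  qed
qed

text \<open>The hub distances differ by at most \<open>q - 1\<close>, so crossing the second path
  from the other hub is no shortcut.\<close>

lemma bicyclic3_dist_hubs:
  assumes "p \<ge> 1" "q \<ge> 2" "r \<ge> 1" "x \<in> {1..p}"
  shows "bicyclic3_dist p q r x (p + 1) = hub_start_dist p q r x"
    and "bicyclic3_dist p q r x (p + q) = hub_end_dist p q r x"
  using hub_dist_bounds[OF assms refl refl] assms by (simp_all add: bicyclic3_dist_regions(2))

lemma min_le_min_plus: "a \<le> c + e \<Longrightarrow> b \<le> d + e \<Longrightarrow> min a b \<le> min c d + e" for a b c d e :: nat
  by simp

text \<open>Inside a path every term of the minimum changes by at most 1, so the minima compare term
  by term. At a hub the bounds between \<open>a\<close>, \<open>b\<close> and the path lengths take
  over.\<close>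

lemma bicyclic3_dist_edge:
  assumes "p \<ge> 1" "q \<ge> 2" "r \<ge> 1" "x \<in> {1..p}" "(u, v) \<in> bicyclic3_edges p q r"
  defines "f \<equiv> bicyclic3_dist p q r x"
  shows "f u \<le> f v + 1 \<and> f v \<le> f u + 1"
proof -
  obtain a b where ab: "a = hub_start_dist p q r x" "b = hub_end_dist p q r x" by blast
  note bounds = hub_dist_bounds[OF assms(1-4) ab]
  note P = bicyclic3_dist_regions(1)[of _ p q r x, folded ab f_def]
    and Q = bicyclic3_dist_regions(2)[of p _ q r x, folded ab f_def]
    and R = bicyclic3_dist_regions(3)[of p q _ r x, folded ab f_def]
  note hubs = bicyclic3_dist_hubs[OF assms(1-4), folded ab f_def]
  have x: "1 \<le> x" "x \<le> p" using assms(4) by auto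
  show ?thesis
    using assms(5)
  proof (cases rule: bicyclic3_edges_cases)
    case 1
    then have "u \<le> p" "v \<le> p" by auto
    then show ?thesis
      unfolding P[OF \<open>u \<le> p\<close>] P[OF \<open>v \<le> p\<close>] using 1 by (intro conjI min_le_min_plus) auto
  next
    case 2
    then have u: "p + 1 \<le> u" "u \<le> p + q" and v: "p + 1 \<le> v" "v \<le> p + q" by auto
    show ?thesis
      unfolding Q[OF u] Q[OF v] using 2 by (intro conjI min_le_min_plus) auto
  next
    case 3
    then have u: "p + q + 1 \<le> u" and v: "p + q + 1 \<le> v" by auto
    show ?thesis
      unfolding R[OF u] R[OF v] using 3 by (intro conjI min_le_min_plus) auto
  next
    case 4
    then show ?thesis
      using P[of 1] hubs bounds(1-8) x by (simp add: min_le_iff_disj)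
  next
    case 5
    then show ?thesis
      using R[of "p + q + 1"] hubs bounds(1-8) by (simp add: min_le_iff_disj)
  next
    case 6
    then show ?thesis
      using P[of p] hubs bounds(1-8) x by (simp add: min_le_iff_disj)
  next
    case 7
    then show ?thesis
      using R[of "p + q + r"] hubs bounds(1-8) assms(3) by (simp add: min_le_iff_disj)
  qed
qed

text \<open>Away from the hubs, one step along the route attaining the minimum lowers that term. At
  a hub, the step goes into a path realising the hub distance.\<close>

lemma bicyclic3_dist_descent:
  assumes "p \<ge> 1" "q \<ge> 2" "r \<ge> 1" "x \<in> {1..p}" "v \<in> {1..p + q + r}" "v \<noteq> x"
  defines "f \<equiv> bicyclic3_dist p q r x"
  shows "\<exists>u. bicyclic3_adj p q r u v \<and> f u < f v"
proof -
  obtain a b where ab: "a = hub_start_dist p q r x" "b = hub_end_dist p q r x" by blast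
  note bounds = hub_dist_bounds[OF assms(1-4) ab]
  note P = bicyclic3_dist_regions(1)[of _ p q r x, folded ab f_def]
    and Q = bicyclic3_dist_regions(2)[of p _ q r x, folded ab f_def]
    and R = bicyclic3_dist_regions(3)[of p q _ r x, folded ab f_def]
  note hubs = bicyclic3_dist_hubs[OF assms(1-4), folded ab f_def]
  have x: "1 \<le> x" "x \<le> p" using assms(4) by auto
  \<comment> \<open>In the numbered references, 1 to 7 are the edge rules, 8 to 14 the same edges
    reversed, and 15 to 17 the path edges seen from their upper end.\<close>
  note adj = bicyclic3_adjI bicyclic3_adjI[THEN bicyclic3_adj_sym] bicyclic3_adj_predI
  consider "1 \<le> v" "v \<le> p" | "v = p + 1" | "v = p + q" | "p + 1 < v" "v < p + q"
    | "p + q + 1 \<le> v" "v \<le> p + q + r"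
    using assms(5) by fastforce
  then show ?thesis
  proof cases
    case 1
    from P[OF 1(2)] consider "f v = v - x + (x - v)" | "f v = a + v" | "f v = b + (p + 1 - v)"
      unfolding min_def by argo
    then show ?thesis
    proof cases
      case dist: 1
      show ?thesis
      proof (cases "v < x")
        case True
        then have "f (v + 1) < f v" using P[of "v + 1"] dist x by (auto simp: min_less_iff_disj)
        moreover have "bicyclic3_adj p q r (v + 1) v" using 1 True x by (intro adj) auto
        ultimately show ?thesis by blast
      next
        case False
        then have "x < v" using assms(6) by simp
        then have "f (v - 1) < f v" using P[of "v - 1"] dist 1 by (auto simp: min_less_iff_disj)
        moreover have "bicyclic3_adj p q r (v - 1) v" using 1 \<open>x < v\<close> x by (intro adj) auto
        ultimately show ?thesis by blast
      qed
    next
      case start: 2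
      show ?thesis
      proof (cases "v = 1")
        case True
        then show ?thesis using start hubs(1) adj(11) by auto
      next
        case False
        then have "f (v - 1) < f v" using P[of "v - 1"] start 1 by (auto simp: min_less_iff_disj)
        moreover have "bicyclic3_adj p q r (v - 1) v" using 1 False by (intro adj) auto
        ultimately show ?thesis by blast
      qed
    next
      case "end": 3
      show ?thesis
      proof (cases "v = p")
        case True
        then show ?thesis using "end" hubs(2) adj(13) by auto
      next
        case False
        then have "f (v + 1) < f v" using P[of "v + 1"] "end" 1 by (auto simp: min_less_iff_disj)
        moreover have "bicyclic3_adj p q r (v + 1) v" using 1 False by (intro adj) auto
        ultimately show ?thesis by blast
      qed
    qed
  next
    case 2
    from bounds(9) consider "a = x" | "a = b + (q - 1)" | "a = b + (r + 1)" by blast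
    \<comment> \<open>Each bound is one less than the corresponding alternative for
      \<open>a\<close>, so the neighbour on the realising path lies strictly below the hub.\<close>
    moreover have "f 1 \<le> x - 1" "f (p + 2) \<le> b + (q - 2)" "f (p + q + 1) \<le> b + r"
      using P[of 1] Q[of "p + 2"] R[of "p + q + 1"] assms(1,2) x by simp_all
    ultimately have "f 1 < a \<or> f (p + 2) < a \<or> f (p + q + 1) < a"
      using assms(2) x by cases linarith+
    moreover have "bicyclic3_adj p q r (p + 2) v"
      using 2 assms(2) adj(9)[of p "p + 1" q r] by simp
    ultimately show ?thesis using 2 hubs adj(4,5) by metis
  next
    case 3
    from bounds(10) consider "b = p + 1 - x" | "b = a + (q - 1)" | "b = a + (r + 1)" by blast
    moreover have "f p \<le> p - x" "f (p + q - 1) \<le> a + (q - 2)" "f (p + q + r) \<le> a + r"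
      using P[of p] Q[of "p + q - 1"] R[of "p + q + r"] assms(2,3) x by simp_all
    ultimately have "f p < b \<or> f (p + q - 1) < b \<or> f (p + q + r) < b"
      using assms(2) x by cases linarith+
    moreover have "bicyclic3_adj p q r (p + q - 1) v"
      unfolding 3 using assms(2) by (intro adj) auto
    ultimately show ?thesis using 3 hubs adj(6,7) by metis
  next
    case 4
    then have "p + 1 \<le> v" "v \<le> p + q" by auto
    from Q[OF this] consider "f v = a + (v - (p + 1))" | "f v = b + (p + q - v)"
      unfolding min_def by argo
    then show ?thesis
    proof cases
      case 1
      then have "f (v - 1) < f v" using Q[of "v - 1"] 4 by (auto simp: min_less_iff_disj)
      moreover have "bicyclic3_adj p q r (v - 1) v" using 4 by (intro adj) auto
      ultimately show ?thesis by blast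
    next
      case 2
      then have "f (v + 1) < f v" using Q[of "v + 1"] 4 by (auto simp: min_less_iff_disj)
      moreover have "bicyclic3_adj p q r (v + 1) v" using 4 by (intro adj) auto
      ultimately show ?thesis by blast
    qed
  next
    case 5
    from R[OF 5(1)] consider "f v = a + (v - (p + q))" | "f v = b + (p + q + r + 1 - v)"
      unfolding min_def by argo
    then show ?thesis
    proof cases
      case 1
      show ?thesis
      proof (cases "v = p + q + 1")
        case True
        then show ?thesis using 1 hubs(1) adj(12) by auto
      next
        case False
        then have "f (v - 1) < f v" using R[of "v - 1"] 1 5 by (auto simp: min_less_iff_disj)
        moreover have "bicyclic3_adj p q r (v - 1) v" using 5 False by (intro adj) auto
        ultimately show ?thesis by blast
      qed
    next
      case 2
      show ?thesis
      proof (cases "v = p + q + r")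
        case True
        then show ?thesis using 2 hubs(2) adj(14) by auto
      next
        case False
        then have "f (v + 1) < f v" using R[of "v + 1"] 2 5 by (auto simp: min_less_iff_disj)
        moreover have "bicyclic3_adj p q r (v + 1) v" using 5 False by (intro adj) auto
        ultimately show ?thesis by blast
      qed
    qed
  qed
qed

lemma gdist_bicyclic3:
  assumes "p \<ge> 1" "q \<ge> 2" "r \<ge> 1" "x \<in> {1..p}" "v \<in> {1..p + q + r}"
  shows "gdist (with_proj (bicyclic3 p q r)) v x = bicyclic3_dist p q r x v"
proof -
  interpret pair_graph "bicyclic3 p q r" using assms by (intro bicyclic3_pair_graph)
  show ?thesis
  proof (rule wf_digraph.gdist_eqI[where f = "bicyclic3_dist p q r x"])
    show "wf_digraph (with_proj (bicyclic3 p q r))" by unfold_locales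
    show "v \<in> verts (with_proj (bicyclic3 p q r))" using assms by (simp add: bicyclic3_def)
    show "bicyclic3_dist p q r x u = 0 \<longleftrightarrow> u = x" for u
      using assms by (intro bicyclic3_dist_eq_0_iff)
    show "bicyclic3_dist p q r x (tail (with_proj (bicyclic3 p q r)) e)
        \<le> bicyclic3_dist p q r x (head (with_proj (bicyclic3 p q r)) e) + 1"
      if "e \<in> arcs (with_proj (bicyclic3 p q r))" for e
      using that bicyclic3_dist_edge[OF assms(1-4)] by (cases e) (auto simp: bicyclic3_arc_iff bicyclic3_adj_def)
    show "\<exists>e\<in>arcs (with_proj (bicyclic3 p q r)). tail (with_proj (bicyclic3 p q r)) e = u \<and>
        bicyclic3_dist p q r x (head (with_proj (bicyclic3 p q r)) e) < bicyclic3_dist p q r x u"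
      if u: "u \<in> verts (with_proj (bicyclic3 p q r))" and "u \<noteq> x" for u
    proof -
      have "u \<in> {1..p + q + r}" using u by (simp add: bicyclic3_def)
      then obtain u' where "bicyclic3_adj p q r u' u" "bicyclic3_dist p q r x u' < bicyclic3_dist p q r x u"
        using bicyclic3_dist_descent[OF assms(1-4) _ \<open>u \<noteq> x\<close>] by blast
      then show ?thesis
        using bicyclic3_arc_iff[of u u' p q r] bicyclic3_adj_sym by (intro bexI[of _ "(u, u')"]) auto
    qed
  qed
qed

section \<open>The resolving pairs\<close>

lemma resolving_pairI:
  assumes "x \<in> verts G" "y \<in> verts G" "x \<noteq> y"
    and "\<And>v. v \<in> verts G \<Longrightarrow> gdist G v x = real (f v)"
    and "\<And>v. v \<in> verts G \<Longrightarrow> gdist G v y = real (g v)"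
    and "\<And>u v. u \<in> verts G \<Longrightarrow> v \<in> verts G \<Longrightarrow> f u = f v \<Longrightarrow> g u = g v \<Longrightarrow> u = v"
  shows "resolving_set G [x, y]"
  using assms by (auto simp: resolving_set_def representation_def inj_on_def)

text \<open>
  Distances to the vertices \<open>1\<close> and \<open>1 + d\<close>, where \<open>m = p - d\<close>, of the vertex at position \<open>j\<close>
  on a second or third path, of length \<open>l\<close> between the hubs.
\<close>

definition arm_coords :: "nat \<Rightarrow> nat \<Rightarrow> nat \<Rightarrow> nat \<Rightarrow> nat \<times> nat" where
  "arm_coords m s l j = (min (1 + j) (1 + s + (l - j)), min (m + s + j) (m + (l - j)))"

text \<open>As \<open>j\<close> grows, the second coordinate switches to the route through the end
  hub at \<open>2 * j = l - s\<close>, the first only at \<open>2 * j = l + s\<close>. In the middle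
  range \<open>f\<close> grows while \<open>g\<close> falls.\<close>

lemma arm_coords_cases:
  assumes "arm_coords m s l j = (f, g)" "j \<le> l" "s \<le> l"
  obtains "2 * j + s \<le> l" "f = 1 + j" "g = m + s + j"
  | "l < 2 * j + s" "2 * j \<le> l + s" "f = 1 + j" "g + j = m + l"
  | "l + s < 2 * j" "f + j = 1 + s + l" "g + j = m + l"
  using assms unfolding arm_coords_def prod.inject by (cases "2 * j + s \<le> l"; cases "2 * j \<le> l + s") auto

text \<open>As an integer, \<open>g - f\<close> is \<open>m + s - 1\<close> on the first range,
  falls by 2 per step on the middle one, and is \<open>m - s - 1\<close> on the last. Wherever it is
  constant, \<open>f\<close> is strictly monotone; \<open>1 \<le> s\<close> keeps the two constants
  apart.\<close>

lemma arm_coords_inj: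
  assumes "arm_coords m s l j = arm_coords m s l k" "j \<le> l" "k \<le> l" "1 \<le> s" "s \<le> l"
  shows "j = k"
proof -
  obtain f g where fg: "arm_coords m s l j = (f, g)" by fastforce
  then have fg': "arm_coords m s l k = (f, g)" using assms(1) by simp
  show ?thesis
    using fg assms(2,5)
  proof (cases rule: arm_coords_cases)
    case j: 1
    show ?thesis using fg' assms(3,5) by (cases rule: arm_coords_cases) (use j assms in linarith)+
  next
    case j: 2
    show ?thesis using fg' assms(3,5) by (cases rule: arm_coords_cases) (use j assms in linarith)+
  next
    case j: 3
    show ?thesis using fg' assms(3,5) by (cases rule: arm_coords_cases) (use j assms in linarith)+
  qed
qed

text \<open>On the path of length \<open>s\<close> the sum \<open>f + g\<close> is always
  \<open>m + s + 1\<close>; on a longer path it exceeds this value except at the two hubs.\<close>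

lemma arm_coords_eq_imp_ends:
  assumes "arm_coords m s s j = arm_coords m s l k" "j \<le> s" "k \<le> l" "s < l"
  shows "j = 0 \<and> k = 0 \<or> j = s \<and> k = l"
proof -
  obtain f g where fg: "arm_coords m s s j = (f, g)" by fastforce
  then have fg': "arm_coords m s l k = (f, g)" using assms(1) by simp
  have "f = 1 + j" "g + j = m + s"
    using fg assms(2) by (auto simp: arm_coords_def)
  moreover have "s \<le> l" using assms by auto
  ultimately show ?thesis
    using fg' assms(3) by (elim arm_coords_cases) (use assms in linarith)+
qed

text \<open>In all three ranges \<open>f + g \<ge> m + s + 1\<close>. On the first path, vertices up
  to \<open>1 + d\<close> have \<open>f + g = d\<close> and later ones have \<open>g < m\<close>, so
  neither kind shares its coordinates with a vertex of another path.\<close>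

lemma arm_coords_neq_path_coords:
  assumes "arm_coords m s l j = (f, g)" "j \<le> l" "s \<le> l" "d \<le> m + s"
  shows "f + g \<noteq> d" and "m \<le> g"
  using assms(1-3) by (cases rule: arm_coords_cases; use assms in linarith)+

section \<open>Second and third path of different lengths between the hubs\<close>

text \<open>Rounding \<open>d\<close> down makes the arc from \<open>1\<close> to
  \<open>1 + d\<close> along the first path strictly shorter than the rest of the cycle of length
  \<open>p + 1 + s\<close>. The condition \<open>q \<noteq> r + 2\<close> makes exactly one of the
  other two paths have length \<open>s\<close>, which separates these two paths.\<close>

lemma bicyclic3_resolving_pair_long_path:
  assumes "q \<ge> 2" "r \<ge> 1" "q < p" "r < p" "q \<noteq> r + 2"
  defines "d \<equiv> (p + min (q - 1) (r + 1)) div 2"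
  shows "resolving_set (with_proj (bicyclic3 p q r)) [1, 1 + d]"
proof -
  obtain s where s: "s = min (q - 1) (r + 1)" by blast
  have s_bounds: "s \<le> q - 1" "s \<le> r + 1" "1 \<le> s" "s = q - 1 \<and> s < r + 1 \<or> s = r + 1 \<and> s < q - 1"
    using assms(1,2,5) s by auto
  have d: "2 * d \<le> p + s" "p + s \<le> 2 * d + 1"
    unfolding d_def s[symmetric] by auto
  \<comment> \<open>The distance from \<open>1 + d\<close> to the end hub.\<close>
  define m where "m = p - d"
  have d': "d < p" "s < d"
    using d s_bounds assms by linarith+
  then have m: "m + d = p" by (simp add: m_def)
  have p: "p \<ge> 1" "1 \<in> {1..p}" "1 + d \<in> {1..p}"
    using d' by auto
  have hub1: "hub_start_dist p q r 1 = 1" "hub_end_dist p q r 1 = 1 + s"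
    unfolding hub_start_dist_def hub_end_dist_def s[symmetric] using d' p by auto
  have hub2: "hub_start_dist p q r (1 + d) = m + s" "hub_end_dist p q r (1 + d) = m"
    unfolding hub_start_dist_def hub_end_dist_def s[symmetric] using d d' m by auto
  define f where "f = bicyclic3_dist p q r 1"
  define g where "g = bicyclic3_dist p q r (1 + d)"
  \<comment> \<open>The bounds on \<open>2 * d\<close> make \<open>f\<close> direct up to
    \<open>1 + d\<close> and routed round through the end hub afterwards. The sum
    \<open>f + g\<close> is \<open>d\<close> on the first part and \<open>p + s + 1 - d\<close>,
    which is larger, on the second.\<close>
  have P: "v \<le> d + 1 \<and> f v + 1 = v \<and> g v + v = d + 1 \<or> d + 2 \<le> v \<and> f v + v = p + s + 2 \<and> g v + d + 1 = v"
    if v: "1 \<le> v" "v \<le> p" for v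
  proof -
    have f: "f v = min (v - 1 + (1 - v)) (min (1 + v) (1 + s + (p + 1 - v)))"
      and g: "g v = min (v - (1 + d) + (1 + d - v)) (min (m + s + v) (m + (p + 1 - v)))"
      unfolding f_def g_def bicyclic3_dist_regions(1)[OF v(2)] hub1 hub2 by simp_all
    show ?thesis
    proof (cases "v \<le> d + 1")
      case True
      then have "f v = v - 1" "g v = 1 + d - v"
        unfolding f g using v d d' m by auto
      then show ?thesis using True v by simp
    next
      case False
      then have "f v = 1 + s + (p + 1 - v)" "g v = v - (1 + d)"
        unfolding f g using v d d' m by auto
      then show ?thesis using False v by simp
    qed
  qed
  have Q: "(f v, g v) = arm_coords m s (q - 1) (v - (p + 1))" if v: "p + 1 \<le> v" "v \<le> p + q" for v
  proof -
    have "q - 1 - (v - (p + 1)) = p + q - v" using v by simp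
    then show ?thesis
      unfolding f_def g_def bicyclic3_dist_regions(2)[OF v] hub1 hub2 arm_coords_def by simp
  qed
  have R: "(f v, g v) = arm_coords m s (r + 1) (v - (p + q))" if v: "p + q + 1 \<le> v" for v
  proof -
    have "r + 1 - (v - (p + q)) = p + q + r + 1 - v" using v by simp
    then show ?thesis
      unfolding f_def g_def bicyclic3_dist_regions(3)[OF v] hub1 hub2 arm_coords_def by simp
  qed
  have arm: False if "(f u, g u) = arm_coords m s l j" "j \<le> l" "s \<le> l" "1 \<le> u" "u \<le> p" for u l j
    using arm_coords_neq_path_coords[of m s l j "f u" "g u" d] that P[of u] d m by auto
  have neq: False if uv: "1 \<le> u" "u < v" "v \<le> p + q + r" and eq: "f u = f v" "g u = g v" for u v
  proof -
    consider "v \<le> p" | "u \<le> p" "p + 1 \<le> v" "v \<le> p + q" | "u \<le> p" "p + q + 1 \<le> v"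
      | "p + 1 \<le> u" "v \<le> p + q" | "p + 1 \<le> u" "u \<le> p + q" "p + q + 1 \<le> v" | "p + q + 1 \<le> u"
      by linarith
    then show False
    proof cases
      case 1
      then show False using P[of u] P[of v] uv eq d by auto
    next
      case 2
      then have "v - (p + 1) \<le> q - 1" by linarith
      with 2 show False
        using arm[of u "q - 1" "v - (p + 1)"] Q[of v] uv eq s_bounds(1) by auto
    next
      case 3
      then have "v - (p + q) \<le> r + 1" using uv(3) by linarith
      with 3 show False
        using arm[of u "r + 1" "v - (p + q)"] R[of v] uv eq s_bounds(2) by auto
    next
      case 4
      then have "u - (p + 1) = v - (p + 1)"
        using Q[of u] Q[of v] uv eq s_bounds(1,3)
        by (intro arm_coords_inj[of m s "q - 1"]) auto
      then show False using 4 uv by simp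
    next
      case 5
      then have coords: "arm_coords m s (q - 1) (u - (p + 1)) = arm_coords m s (r + 1) (v - (p + q))"
        using Q[of u] R[of v] eq by simp
      \<comment> \<open>The vertex \<open>v\<close> is interior to the third path, whereas equal
        coordinates on paths of different lengths force both positions to be hubs.\<close>
      have range: "u - (p + 1) \<le> q - 1" "1 \<le> v - (p + q)" "v - (p + q) < r + 1"
        using 5 uv(3) by linarith+
      from s_bounds(4) show False
      proof
        assume s: "s = q - 1 \<and> s < r + 1"
        have "arm_coords m s s (u - (p + 1)) = arm_coords m s (r + 1) (v - (p + q))"
          using coords s by metis
        then show False
          using arm_coords_eq_imp_ends[of m s "u - (p + 1)" "r + 1" "v - (p + q)"] s range by linarith
      next
        assume s: "s = r + 1 \<and> s < q - 1"
        have "arm_coords m s s (v - (p + q)) = arm_coords m s (q - 1) (u - (p + 1))"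
          using coords s by metis
        then show False
          using arm_coords_eq_imp_ends[of m s "v - (p + q)" "q - 1" "u - (p + 1)"] s range by linarith
      qed
    next
      case 6
      then have "u - (p + q) = v - (p + q)"
        using R[of u] R[of v] uv eq s_bounds(2,3)
        by (intro arm_coords_inj[of m s "r + 1"]) auto
      then show False using 6 uv by simp
    qed
  qed
  show ?thesis
  proof (rule resolving_pairI[where f = f and g = g])
    show "1 \<in> verts (with_proj (bicyclic3 p q r))" "1 + d \<in> verts (with_proj (bicyclic3 p q r))"
      using p by (auto simp: bicyclic3_def)
    show "1 \<noteq> 1 + d" using d' by simp
    show "gdist (with_proj (bicyclic3 p q r)) v 1 = real (f v)"
      if "v \<in> verts (with_proj (bicyclic3 p q r))" for v
      using gdist_bicyclic3[OF p(1) assms(1,2) p(2), of v] that by (simp add: f_def bicyclic3_def)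
    show "gdist (with_proj (bicyclic3 p q r)) v (1 + d) = real (g v)"
      if "v \<in> verts (with_proj (bicyclic3 p q r))" for v
      using gdist_bicyclic3[OF p(1) assms(1,2) p(3), of v] that by (simp add: g_def bicyclic3_def)
    show "u = v"
      if "u \<in> verts (with_proj (bicyclic3 p q r))" "v \<in> verts (with_proj (bicyclic3 p q r))"
        "f u = f v" "g u = g v" for u v
      using that neq[of u v] neq[of v u] by (auto simp: bicyclic3_def intro: linorder_cases)
  qed
qed

section \<open>Second and third path of equal length between the hubs\<close>

text \<open>The integer \<open>f - g\<close> is 0 on the second path before its last vertex, 2 at
  that vertex and on the third path, and between -2 and 2 on the first. Where it is 2,
  \<open>g\<close> is below \<open>r\<close> on the third path, \<open>r\<close> at the end hub and
  above \<open>r\<close> on the first path. Where it is 0, \<open>g\<close> is at most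
  \<open>r + 1\<close> on the second path and larger on the first, because
  \<open>q < p\<close>.\<close>

lemma bicyclic3_resolving_pair_balanced:
  assumes "r \<ge> 1" "q < p" "q = r + 2"
  shows "resolving_set (with_proj (bicyclic3 p q r)) [1, p + q + 1]"
proof -
  have p: "p \<ge> 1" "1 \<in> {1..p}" and q: "q \<ge> 2" and r: "1 \<in> {1..r}"
    using assms by auto
  have hub1: "hub_start_dist p q r 1 = 1" "hub_end_dist p q r 1 = r + 2"
    using assms by (auto simp: hub_start_dist_def hub_end_dist_def)
  have hub2: "hub_start_dist r q p 1 = 1" "hub_end_dist r q p 1 = r"
    using assms by (auto simp: hub_start_dist_def hub_end_dist_def)
  define f where "f = bicyclic3_dist p q r 1"
  \<comment> \<open>The distance formula covers targets on the first path only; the swap moves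
    \<open>p + q + 1\<close> to the vertex \<open>1\<close> of the exchanged graph.\<close>
  define g where "g v = bicyclic3_dist r q p 1 (bicyclic3_swap p q r v)" for v
  have P: "2 * v \<le> r + p \<and> f v + 1 = v \<and> g v = 1 + v \<or>
      r + p < 2 * v \<and> 2 * v \<le> r + p + 4 \<and> f v + 1 = v \<and> g v + v = r + p + 1 \<or>
      r + p + 4 < 2 * v \<and> f v + v = r + p + 3 \<and> g v + v = r + p + 1"
    if v: "1 \<le> v" "v \<le> p" for v
  proof -
    have f: "f v = min (v - 1 + (1 - v)) (min (1 + v) (r + 2 + (p + 1 - v)))"
      unfolding f_def bicyclic3_dist_regions(1)[OF v(2)] hub1 by simp
    have swap: "bicyclic3_swap p q r v = v + q + r" "r + q + 1 \<le> v + q + r"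
      using v by (auto simp: bicyclic3_swap_def)
    have "v + q + r - (r + q) = v" "r + q + p + 1 - (v + q + r) = p + 1 - v" by auto
    then have g: "g v = min (1 + v) (r + (p + 1 - v))"
      unfolding g_def swap(1) bicyclic3_dist_regions(3)[OF swap(2)] hub2 by simp
    consider "2 * v \<le> r + p" | "r + p < 2 * v" "2 * v \<le> r + p + 4" | "r + p + 4 < 2 * v" by linarith
    then show ?thesis
      unfolding f g using v by cases auto
  qed
  \<comment> \<open>The end hub is exceptional: its shortest route to \<open>p + q + 1\<close> runs
    along the third path and has length \<open>r\<close>.\<close>
  have Q: "f v + p = v \<and> (v \<le> p + r + 1 \<and> g v + p = v \<or> v = p + q \<and> g v = r)"
    if v: "p + 1 \<le> v" "v \<le> p + q" for v
  proof -
    have f: "f v = min (1 + (v - (p + 1))) (r + 2 + (p + q - v))"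
      unfolding f_def bicyclic3_dist_regions(2)[OF v] hub1 by simp
    have swap: "bicyclic3_swap p q r v = v - p + r" "r + 1 \<le> v - p + r" "v - p + r \<le> r + q"
      using v by (auto simp: bicyclic3_swap_def)
    have "v - p + r - (r + 1) = v - (p + 1)" "r + q - (v - p + r) = p + q - v" using v by auto
    then have g: "g v = min (1 + (v - (p + 1))) (r + (p + q - v))"
      unfolding g_def swap(1) bicyclic3_dist_regions(2)[OF swap(2,3)] hub2 by simp
    show ?thesis
      unfolding f g using v assms(3) by auto
  qed
  have R: "f v + p + q = v + 1 \<and> g v + p + q + 1 = v" if v: "p + q + 1 \<le> v" "v \<le> p + q + r" for v
  proof -
    have f: "f v = min (1 + (v - (p + q))) (r + 2 + (p + q + r + 1 - v))"
      unfolding f_def bicyclic3_dist_regions(3)[OF v(1)] hub1 by simp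
    have swap: "bicyclic3_swap p q r v = v - p - q" "v - p - q \<le> r"
      using v by (auto simp: bicyclic3_swap_def)
    have g: "g v = min (v - p - q - 1 + (1 - (v - p - q))) (min (1 + (v - p - q)) (r + (r + 1 - (v - p - q))))"
      unfolding g_def swap(1) bicyclic3_dist_regions(1)[OF swap(2)] hub2 by simp
    show ?thesis
      unfolding f g using v assms(3) by auto
  qed
  have neq: False if uv: "1 \<le> u" "u < v" "v \<le> p + q + r" and eq: "f u = f v" "g u = g v" for u v
  proof -
    consider "v \<le> p" | "u \<le> p" "p + 1 \<le> v" "v \<le> p + q" | "u \<le> p" "p + q + 1 \<le> v"
      | "p + 1 \<le> u" "v \<le> p + q" | "p + 1 \<le> u" "u \<le> p + q" "p + q + 1 \<le> v" | "p + q + 1 \<le> u"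
      by linarith
    then show False
    proof cases
      case 1
      then show False using P[of u] P[of v] uv eq by linarith
    next
      case 2
      then show False using P[of u] Q[of v] uv eq assms by linarith
    next
      case 3
      then show False using P[of u] R[of v] uv eq assms by linarith
    next
      case 4
      then show False using Q[of u] Q[of v] uv eq by linarith
    next
      case 5
      then show False using Q[of u] R[of v] uv eq assms by linarith
    next
      case 6
      then show False using R[of u] R[of v] uv eq by linarith
    qed
  qed
  show ?thesis
  proof (rule resolving_pairI[where f = f and g = g])
    show "1 \<in> verts (with_proj (bicyclic3 p q r))" "p + q + 1 \<in> verts (with_proj (bicyclic3 p q r))"
      using p assms(1) by (auto simp: bicyclic3_def)
    show "1 \<noteq> p + q + 1" using p by simp
    show "gdist (with_proj (bicyclic3 p q r)) v 1 = real (f v)"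
      if "v \<in> verts (with_proj (bicyclic3 p q r))" for v
      using gdist_bicyclic3[OF p(1) q assms(1) p(2), of v] that by (simp add: f_def bicyclic3_def)
    show "gdist (with_proj (bicyclic3 p q r)) v (p + q + 1) = real (g v)"
      if "v \<in> verts (with_proj (bicyclic3 p q r))" for v
    proof -
      have v: "v \<in> {1..p + q + r}" using that by (simp add: bicyclic3_def)
      have "bicyclic3_swap p q r (p + q + 1) = 1" by (simp add: bicyclic3_swap_def)
      moreover have "bicyclic3_swap p q r v \<in> {1..r + q + p}"
        using bicyclic3_swap_vert[OF v] by (simp add: add_ac)
      ultimately show ?thesis
        using gdist_bicyclic3_swap[OF p(1) q assms(1) v, of "p + q + 1"] assms(1)
          gdist_bicyclic3[OF assms(1) q p(1) r, of "bicyclic3_swap p q r v"]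
        by (simp add: g_def)
    qed
    show "u = v"
      if "u \<in> verts (with_proj (bicyclic3 p q r))" "v \<in> verts (with_proj (bicyclic3 p q r))"
        "f u = f v" "g u = g v" for u v
      using that neq[of u v] neq[of v u] by (auto simp: bicyclic3_def intro: linorder_cases)
  qed
qed

lemma bicyclic3_resolving_pair:
  assumes "q \<ge> 2" "r \<ge> 1" "q < p" "r < p"
  shows "\<exists>ws. resolving_set (with_proj (bicyclic3 p q r)) ws \<and> length ws = 2"
proof (cases "q = r + 2")
  case True
  then show ?thesis
    using bicyclic3_resolving_pair_balanced[of r q p] assms by force
next
  case False
  then show ?thesis
    using bicyclic3_resolving_pair_long_path[of q r p] assms by force
qed

theorem theorem6:
  fixes p q r :: nat
  assumes "p \<ge> 1" and "r \<ge> 1" and "q \<ge> 2"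
    and "(p > q \<and> p > r) \<or> (r > q \<and> r > p)"
  shows "metric_dimension (with_proj (bicyclic3 p q r)) = 2"
  unfolding metric_dimension_def
proof (rule Least_equality)
  show "\<exists>ws. resolving_set (with_proj (bicyclic3 p q r)) ws \<and> length ws = 2"
    using assms(4)
  proof
    assume "p > q \<and> p > r"
    then show ?thesis using assms by (intro bicyclic3_resolving_pair) auto
  next
    assume "r > q \<and> r > p"
    then obtain ws where "resolving_set (with_proj (bicyclic3 r q p)) ws" "length ws = 2"
      using bicyclic3_resolving_pair[of q p r] assms by auto
    then show ?thesis
      using resolving_set_bicyclic3_swap[of r q p ws] assms by (metis length_map)
  qed
next
  fix k
  assume "\<exists>ws. resolving_set (with_proj (bicyclic3 p q r)) ws \<and> length ws = k"
  then obtain ws where ws: "resolving_set (with_proj (bicyclic3 p q r)) ws" "length ws = k" by blast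
  interpret pair_graph "bicyclic3 p q r" using assms by (intro bicyclic3_pair_graph)
  have fin: "fin_digraph (with_proj (bicyclic3 p q r))" by unfold_locales
  have "2 \<le> length ws"
  proof (rule fin_digraph.resolving_set_length_ge_2[OF fin ws(1)])
    show "verts (with_proj (bicyclic3 p q r)) \<noteq> {}"
      using assms by (fastforce simp: bicyclic3_def)
    fix w
    assume "w \<in> verts (with_proj (bicyclic3 p q r))"
    then have "w \<in> {1..p + q + r}" by (simp add: bicyclic3_def)
    then obtain u v where "bicyclic3_adj p q r u w" "bicyclic3_adj p q r v w" "distinct [u, v, w]"
      using bicyclic3_two_neighbours[OF assms(1,3,2)] by blast
    then show "\<exists>u v. u \<rightarrow>\<^bsub>with_proj (bicyclic3 p q r)\<^esub> w \<and> v \<rightarrow>\<^bsub>with_proj (bicyclic3 p q r)\<^esub> w \<and>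
        distinct [u, v, w]"
      using bicyclic3_arc_iff[of _ w p q r] by auto
  qed
  then show "2 \<le> k" using ws(2) by simp
qed

end
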